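(* Let $X=\{X_1,\dots,X_n\}$ be a set of $n$ continuous real-valued random variables and let $Y$ be a discrete random variable taking values in $\{1,\dots,c\}$, all defined on a common probability space. Let $\mathbb{S}\subseteq\{1,\dots,n\}$ be a subset of $k$ indices, $1\le k\le n$, and let $X_{\mathbb{S}}=\{X_i : i\in\mathbb{S}\}$. Then $$p(Y\mid X)=p(Y\mid X_{\mathbb{S}})\quad\text{if and only if}\quad I(X;Y)=I(X_{\mathbb{S}};Y).$$
   Context: $X$ is identified with the random vector $(X_1,\dots,X_n)$ and $X_{\mathbb{S}}$ with the random vector $(X_i)_{i\in\mathbb{S}}$. $p(Y\mid X)$ and $p(Y\mid X_{\mathbb{S}})$ denote the conditional (posterior) distributions of $Y$ given $X$ and given $X_{\mathbb{S}}$; the equality $p(Y\mid X)=p(Y\mid X_{\mathbb{S}})$ means $P(Y=y\mid X)=P(Y=y\mid X_{\mathbb{S}})$ almost surely for every $y\in\{1,\dots,c\}$. $I(A;B)$ denotes the mutual information between random vectors $A$ and $B$, i.e. the Kullback–Leibler divergence of the joint law of $(A,B)$ from the product of the marginal laws; equivalently $I(A;B)=H(A)-H(A\mid B)=H(B)-H(B\mid A)$, with $H$ the entropy, when these entropies are defined and finite. *)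

theory Defs
  imports "HOL-Probability.Probability"
begin

text \<open>
  A real random variable is continuous if its distribution function is continuous, i.e. no value
  is attained with positive probability. This includes every variable with a Lebesgue density,
  and no joint density is required of a family of such variables.
\<close>

definition continuous_rv :: "'a measure \<Rightarrow> ('a \<Rightarrow> real) \<Rightarrow> bool" where
  "continuous_rv M X \<longleftrightarrow>
    X \<in> borel_measurable M \<and> continuous_on UNIV (cdf (distr M borel X))"

definition rvec_space :: "nat set \<Rightarrow> (nat \<Rightarrow> real) measure" where
  "rvec_space J = (\<Pi>\<^sub>M i\<in>J. borel)"

text \<open>Coordinates outside \<open>J\<close> are \<open>undefined\<close>, as required for membership in the product space.\<close>

definition rvec :: "nat set \<Rightarrow> (nat \<Rightarrow> 'a \<Rightarrow> real) \<Rightarrow> 'a \<Rightarrow> nat \<Rightarrow> real" where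
  "rvec J X \<omega> = (\<lambda>i\<in>J. X i \<omega>)"

text \<open>
  \<open>posterior M T Z Y y\<close> is a version of \<open>P(Y = y | Z)\<close> for a random variable \<open>Z\<close> with values in
  the measurable space \<open>T\<close>: the conditional expectation of the indicator of \<open>Y = y\<close> given the
  sigma-algebra generated by \<open>Z\<close>. It is determined only almost surely.
\<close>

definition posterior ::
  "'a measure \<Rightarrow> 'b measure \<Rightarrow> ('a \<Rightarrow> 'b) \<Rightarrow> ('a \<Rightarrow> nat) \<Rightarrow> nat \<Rightarrow> 'a \<Rightarrow> real" where
  "posterior M T Z Y y =
    real_cond_exp M (vimage_algebra (space M) Z T) (indicator {\<omega> \<in> space M. Y \<omega> = y})"

end

theory Submission
  imports Defs
begin

text \<open>
  Let \<open>f\<^sub>y\<close> and \<open>g\<^sub>y\<close> be the posterior probabilities of \<open>Y = y\<close> given \<open>X\<close> and given \<open>X\<^sub>S\<close>. The joint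
  law of \<open>(X, Y)\<close> has density \<open>f\<^sub>y / P(Y = y)\<close> with respect to the product of the marginals, so
  \<open>I(X; Y)\<close> is, up to the factor \<open>1 / ln b\<close>, the sum over \<open>y\<close> of \<open>E[f\<^sub>y ln f\<^sub>y] - P(Y = y) ln P(Y = y)\<close>,
  and likewise for \<open>X\<^sub>S\<close>. As \<open>g\<^sub>y\<close> is the conditional expectation of \<open>f\<^sub>y\<close> given \<open>X\<^sub>S\<close>, Jensen's
  inequality for the strictly convex \<open>t ln t\<close> gives \<open>E[g\<^sub>y ln g\<^sub>y] \<le> E[f\<^sub>y ln f\<^sub>y]\<close> with equality only
  if \<open>f\<^sub>y = g\<^sub>y\<close> almost surely. Hence the mutual informations agree iff all these terms agree.
\<close>

section \<open>Strict Jensen inequality for conditional expectations and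
  \<open>t * ln t\<close>\<close>

text \<open>Both versions have the same integrals over the sets of \<open>F\<close>, which
  characterizes \<open>nn_cond_exp\<close>. This gives access to integral identities in
  \<open>ennreal\<close>, which can be applied before integrability of a product is known.\<close>

lemma (in sigma_finite_subalgebra) nn_cond_exp_eq_real_cond_exp:
  fixes f :: "'a \<Rightarrow> real"
  assumes f: "integrable M f" and nn: "AE x in M. 0 \<le> f x"
  shows "AE x in M. ennreal (real_cond_exp M F f x) = nn_cond_exp M F (\<lambda>x. ennreal (f x)) x"
proof (rule nn_cond_exp_charact)
  have pos: "AE x in M. 0 \<le> real_cond_exp M F f x"
    using nn f by (intro real_cond_exp_pos) auto
  fix A assume A: "A \<in> sets F"
  then have AM [measurable]: "A \<in> sets M"
    using subalg by (auto simp: subalgebra_def)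
  have "(\<integral>\<^sup>+x\<in>A. ennreal (f x) \<partial>M) = (\<integral>\<^sup>+x. ennreal (indicator A x * f x) \<partial>M)"
    by (intro nn_integral_cong) (auto split: split_indicator)
  also have "\<dots> = ennreal (\<integral>x. indicator A x * f x \<partial>M)"
    using nn f AM by (intro nn_integral_eq_integral) (auto intro: integrable_real_mult_indicator simp: mult.commute)
  also have "\<dots> = ennreal (\<integral>x. indicator A x * real_cond_exp M F f x \<partial>M)"
    using real_cond_exp_intA[OF f A] by (simp add: set_lebesgue_integral_def)
  also have "\<dots> = (\<integral>\<^sup>+x. ennreal (indicator A x * real_cond_exp M F f x) \<partial>M)"
    using pos integrable_real_mult_indicator[OF AM real_cond_exp_int(1)[OF f]]
    by (intro nn_integral_eq_integral[symmetric]) (auto simp: mult.commute)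
  also have "\<dots> = (\<integral>\<^sup>+x\<in>A. ennreal (real_cond_exp M F f x) \<partial>M)"
    by (intro nn_integral_cong) (auto split: split_indicator)
  finally show "(\<integral>\<^sup>+x\<in>A. ennreal (f x) \<partial>M) = (\<integral>\<^sup>+x\<in>A. ennreal (real_cond_exp M F f x) \<partial>M)" .
qed (use f in auto)

text \<open>The inequality \<open>ln u \<le> u - 1\<close> at \<open>u = 1 / t\<close> bounds
  \<open>- t * ln t\<close> by \<open>1 - t\<close>. The bound makes \<open>f * ln f\<close>
  integrable on a probability space whenever \<open>f\<close> takes values in the unit
  interval.\<close>

lemma abs_mult_ln_le_1:
  fixes t :: real
  assumes "0 \<le> t" "t \<le> 1"
  shows "\<bar>t * ln t\<bar> \<le> 1"
proof (cases "t = 0")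
  case False
  with assms have t: "0 < t" by simp
  have "ln (1 / t) \<le> 1 / t - 1" using t by (intro ln_le_minus_one) simp
  then have "t * ln (1 / t) \<le> t * (1 / t - 1)"
    using t by (intro mult_left_mono) auto
  then have "- (t * ln t) \<le> 1 - t"
    using t by (simp add: ln_div algebra_simps)
  moreover have "t * ln t \<le> 0"
    using t assms by (intro mult_nonneg_nonpos) auto
  ultimately show ?thesis using assms by simp
qed simp

text \<open>For positive \<open>s\<close> the expression is the height of the graph of
  \<open>t * ln t\<close> above its tangent at \<open>s\<close>. The substitution
  \<open>u = s / t\<close> reduces it to \<open>ln u \<le> u - 1\<close>, with equality only at
  \<open>u = 1\<close>. At \<open>s = 0\<close> there is no tangent, so the third assumption forces
  \<open>t = 0\<close> there.\<close>

lemma mult_ln_gap: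
  fixes s t :: real
  assumes "0 \<le> t" "0 \<le> s" "s = 0 \<longrightarrow> t = 0"
  shows "0 \<le> t * ln t - ln s * t - t + s"
    and "t * ln t - ln s * t - t + s = 0 \<Longrightarrow> t = s"
proof -
  have "0 \<le> t * ln t - ln s * t - t + s \<and> (t * ln t - ln s * t - t + s = 0 \<longrightarrow> t = s)"
  proof (cases "t = 0")
    case False
    with assms have t: "0 < t" and s: "0 < s" by auto
    have eq: "t * ln t - ln s * t - t + s = t * ((s / t - 1) - ln (s / t))"
      using t s by (simp add: ln_div field_simps)
    show ?thesis
      unfolding eq using t s ln_le_minus_one[of "s / t"] ln_eq_minus_one[of "s / t"]
      by auto
  qed (use assms in auto)
  then show "0 \<le> t * ln t - ln s * t - t + s"
    and "t * ln t - ln s * t - t + s = 0 \<Longrightarrow> t = s" by auto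
qed

text \<open>Integrate the gap of \<open>mult_ln_gap\<close> with \<open>t = f x\<close> and
  \<open>s = g x\<close>. Since \<open>ln g\<close> is \<open>G\<close>-measurable,
  \<open>ln g * f\<close> has the same integral as \<open>g * ln g\<close>, and the linear terms
  cancel because \<open>f\<close> and \<open>g\<close> have equal means. The integral of the
  nonnegative gap is thus the difference of the two sides, and it vanishes only if the gap does
  almost everywhere.\<close>

lemma (in prob_space) cond_exp_mult_ln:
  fixes f :: "'a \<Rightarrow> real"
  assumes sub: "subalgebra M G"
    and f [measurable]: "f \<in> borel_measurable M"
    and f01: "AE x in M. 0 \<le> f x \<and> f x \<le> 1"
  defines "g \<equiv> real_cond_exp M G f"
  shows "(\<integral>x. g x * ln (g x) \<partial>M) \<le> (\<integral>x. f x * ln (f x) \<partial>M)"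
    and "(\<integral>x. g x * ln (g x) \<partial>M) = (\<integral>x. f x * ln (f x) \<partial>M) \<longleftrightarrow> (AE x in M. f x = g x)"
proof -
  interpret G: finite_measure_subalgebra M G by standard (rule sub)
  have gG [measurable]: "g \<in> borel_measurable G" and g [measurable]: "g \<in> borel_measurable M"
    unfolding g_def by auto
  have intf: "integrable M f"
    using f01 by (intro integrable_const_bound[where B=1]) auto
  have g0: "AE x in M. 0 \<le> g x"
    unfolding g_def using f01 by (intro G.real_cond_exp_pos) auto
  have g1: "AE x in M. g x \<le> 1"
    unfolding g_def using f01 intf by (intro G.real_cond_exp_le_c) auto
  have intg: "integrable M g"
    unfolding g_def using intf by (rule G.real_cond_exp_int)
  have iff: "integrable M (\<lambda>x. f x * ln (f x))"
  proof (rule integrable_const_bound[where B=1])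
    show "AE x in M. norm (f x * ln (f x)) \<le> 1"
      using f01 by eventually_elim (simp add: abs_mult_ln_le_1 del: abs_mult)
  qed simp
  have igg: "integrable M (\<lambda>x. g x * ln (g x))"
  proof (rule integrable_const_bound[where B=1])
    show "AE x in M. norm (g x * ln (g x)) \<le> 1"
      using g0 g1 by eventually_elim (simp add: abs_mult_ln_le_1 del: abs_mult)
  qed simp
  \<comment> \<open>\<open>ln g\<close> is unbounded near \<open>g = 0\<close>, but averaging replaces \<open>f\<close> by \<open>g\<close> and \<open>g ln g\<close> is bounded.\<close>
  have ifg: "integrable M (\<lambda>x. ln (g x) * f x)"
  proof (rule integrableI_bounded)
    have "(\<integral>\<^sup>+x. ennreal (norm (ln (g x) * f x)) \<partial>M) = (\<integral>\<^sup>+x. ennreal \<bar>ln (g x)\<bar> * ennreal (f x) \<partial>M)"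
      by (rule nn_integral_cong_AE) (use f01 in eventually_elim, auto simp: abs_mult ennreal_mult)
    also have "\<dots> = (\<integral>\<^sup>+x. ennreal \<bar>ln (g x)\<bar> * nn_cond_exp M G (\<lambda>x. ennreal (f x)) x \<partial>M)"
      by (rule G.nn_cond_exp_intg[symmetric]) auto
    also have "\<dots> = (\<integral>\<^sup>+x. ennreal (norm (g x * ln (g x))) \<partial>M)"
    proof (rule nn_integral_cong_AE)
      have "AE x in M. ennreal (g x) = nn_cond_exp M G (\<lambda>x. ennreal (f x)) x"
        unfolding g_def using intf f01 by (intro G.nn_cond_exp_eq_real_cond_exp) auto
      then show "AE x in M. ennreal \<bar>ln (g x)\<bar> * nn_cond_exp M G (\<lambda>x. ennreal (f x)) x
          = ennreal (norm (g x * ln (g x)))"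
        using g0 by eventually_elim (metis abs_ge_zero abs_mult abs_of_nonneg ennreal_mult mult.commute real_norm_def)
    qed
    also have "\<dots> < \<infinity>"
      using igg by (simp add: integrable_iff_bounded)
    finally show "(\<integral>\<^sup>+x. ennreal (norm (ln (g x) * f x)) \<partial>M) < \<infinity>" .
  qed simp
  have lng: "(\<lambda>x. ln (g x)) \<in> borel_measurable G" by measurable
  have eq_fg: "(\<integral>x. ln (g x) * f x \<partial>M) = (\<integral>x. g x * ln (g x) \<partial>M)"
    using G.real_cond_exp_intg(2)[OF ifg lng f] by (simp add: g_def mult.commute)
  \<comment> \<open>This supplies the side condition of \<open>mult_ln_gap\<close>. The zero set of
    \<open>g\<close> lies in \<open>G\<close>, so \<open>f\<close> and \<open>g\<close> have the
    same integral over it, namely 0, and \<open>f\<close> is nonnegative.\<close>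
  have null: "AE x in M. g x = 0 \<longrightarrow> f x = 0"
  proof -
    let ?Z = "{x \<in> space M. g x = 0}"
    have Zm [measurable]: "?Z \<in> sets G"
    proof -
      have "{x \<in> space G. g x = 0} \<in> sets G" by measurable
      moreover have "space G = space M" using sub by (simp add: subalgebra_def)
      ultimately show ?thesis by metis
    qed
    have ZM [measurable]: "?Z \<in> sets M" by measurable
    have int: "integrable M (\<lambda>x. indicator ?Z x * f x)"
      using integrable_real_mult_indicator[OF ZM intf] by (simp add: mult.commute)
    have "(\<integral>x. indicator ?Z x * f x \<partial>M) = (\<integral>x. indicator ?Z x * g x \<partial>M)"
      using G.real_cond_exp_intA[OF intf Zm] by (simp add: g_def set_lebesgue_integral_def)
    also have "\<dots> = (\<integral>x. 0 \<partial>M)"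
      by (intro Bochner_Integration.integral_cong) (auto split: split_indicator)
    finally have "(\<integral>x. indicator ?Z x * f x \<partial>M) = 0" by simp
    then have "AE x in M. indicator ?Z x * f x = 0"
      using int f01 by (subst (asm) integral_nonneg_eq_0_iff_AE) (auto split: split_indicator)
    with AE_space show ?thesis by eventually_elim (auto split: split_indicator_asm)
  qed
  let ?k = "\<lambda>x. f x * ln (f x) - ln (g x) * f x - f x + g x"
  have ik: "integrable M ?k" using iff ifg intf intg by auto
  have k0: "AE x in M. 0 \<le> ?k x"
    using null f01 g0 by eventually_elim (rule mult_ln_gap, auto)
  have "(\<integral>x. g x \<partial>M) = (\<integral>x. f x \<partial>M)"
    unfolding g_def using intf by (rule G.real_cond_exp_int)
  then have ek: "(\<integral>x. ?k x \<partial>M) = (\<integral>x. f x * ln (f x) \<partial>M) - (\<integral>x. g x * ln (g x) \<partial>M)"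
    using iff ifg intf intg by (simp add: eq_fg)
  show "(\<integral>x. g x * ln (g x) \<partial>M) \<le> (\<integral>x. f x * ln (f x) \<partial>M)"
    using integral_nonneg_AE[OF k0] unfolding ek by simp
  have "(\<integral>x. g x * ln (g x) \<partial>M) = (\<integral>x. f x * ln (f x) \<partial>M) \<longleftrightarrow> (\<integral>x. ?k x \<partial>M) = 0"
    unfolding ek by auto
  also have "\<dots> \<longleftrightarrow> (AE x in M. ?k x = 0)"
    by (rule integral_nonneg_eq_0_iff_AE[OF ik k0])
  also have "\<dots> \<longleftrightarrow> (AE x in M. f x = g x)"
  proof
    assume "AE x in M. ?k x = 0"
    then show "AE x in M. f x = g x"
      using null f01 g0 by eventually_elim (rule mult_ln_gap, auto)
  qed (auto elim!: eventually_mono simp: algebra_simps)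
  finally show "(\<integral>x. g x * ln (g x) \<partial>M) = (\<integral>x. f x * ln (f x) \<partial>M) \<longleftrightarrow> (AE x in M. f x = g x)" .
qed

section \<open>Posteriors as functions of the observed value\<close>

lemma subalgebra_vimage_algebra:
  "Z \<in> measurable M T \<Longrightarrow> subalgebra M (vimage_algebra (space M) Z T)"
  by (auto simp: subalgebra_def sets_vimage_algebra2 measurable_space measurable_sets)

lemma (in prob_space) posterior_bounds:
  assumes Z: "Z \<in> measurable M T" and E: "{\<omega> \<in> space M. Y \<omega> = y} \<in> sets M"
  shows "AE \<omega> in M. 0 \<le> posterior M T Z Y y \<omega> \<and> posterior M T Z Y y \<omega> \<le> 1"
proof -
  interpret F: finite_measure_subalgebra M "vimage_algebra (space M) Z T"
    by standard (rule subalgebra_vimage_algebra[OF Z])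
  let ?i = "indicator {\<omega> \<in> space M. Y \<omega> = y} :: 'a \<Rightarrow> real"
  have int: "integrable M ?i" using E by (simp add: less_top[symmetric])
  have "AE \<omega> in M. 0 \<le> posterior M T Z Y y \<omega>"
    unfolding posterior_def using E by (intro F.real_cond_exp_pos) auto
  moreover have "AE \<omega> in M. posterior M T Z Y y \<omega> \<le> 1"
    unfolding posterior_def using int by (intro F.real_cond_exp_le_c) auto
  ultimately show ?thesis by eventually_elim simp
qed

text \<open>A Doob-Dynkin factorization made explicit: \<open>\<phi>\<close> is a Radon-Nikodym
  derivative, with respect to the law of \<open>Z\<close>, of the law of \<open>Z\<close> restricted
  to the event \<open>Y = y\<close>. The last clause is what later yields a density of the joint
  law.\<close>

lemma (in prob_space) posterior_factor:
  assumes Z [measurable]: "Z \<in> measurable M T" and E [measurable]: "{\<omega> \<in> space M. Y \<omega> = y} \<in> sets M"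
  obtains \<phi> :: "'b \<Rightarrow> real" where
    "\<phi> \<in> borel_measurable T" "\<And>z. 0 \<le> \<phi> z" "\<And>z. \<phi> z \<le> 1"
    "AE \<omega> in M. posterior M T Z Y y \<omega> = \<phi> (Z \<omega>)"
    "\<And>A. A \<in> sets T \<Longrightarrow> emeasure M {\<omega> \<in> space M. Z \<omega> \<in> A \<and> Y \<omega> = y} =
      (\<integral>\<^sup>+\<omega>. ennreal (\<phi> (Z \<omega>)) * indicator A (Z \<omega>) \<partial>M)"
proof -
  let ?F = "vimage_algebra (space M) Z T"
  let ?E = "{\<omega> \<in> space M. Y \<omega> = y}"
  let ?i = "indicator ?E :: 'a \<Rightarrow> real"
  interpret F: finite_measure_subalgebra M ?F
    by standard (rule subalgebra_vimage_algebra[OF Z])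
  define \<mu> where "\<mu> = distr M T Z"
  \<comment> \<open>The measure sending \<open>A\<close> to the probability that \<open>Z\<close>
    lies in \<open>A\<close> and \<open>Y = y\<close>. It is dominated by the law of
    \<open>Z\<close>, so it has a derivative.\<close>
  define \<nu> where "\<nu> = distr (density M (\<lambda>\<omega>. ennreal (?i \<omega>))) T Z"
  interpret \<mu>: prob_space \<mu> unfolding \<mu>_def by (rule prob_space_distr) fact
  have sets [simp, measurable_cong]: "sets \<mu> = sets T" "sets \<nu> = sets T" by (auto simp: \<mu>_def \<nu>_def)
  have \<nu>_eq: "emeasure \<nu> A = (\<integral>\<^sup>+\<omega>. ennreal (?i \<omega>) * indicator A (Z \<omega>) \<partial>M)" if A [measurable]: "A \<in> sets T" for A
  proof -
    have "emeasure \<nu> A = emeasure (density M (\<lambda>\<omega>. ennreal (?i \<omega>))) (Z -` A \<inter> space M)"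
      unfolding \<nu>_def by (subst emeasure_distr) auto
    also have "\<dots> = (\<integral>\<^sup>+\<omega>. ennreal (?i \<omega>) * indicator (Z -` A \<inter> space M) \<omega> \<partial>M)"
      by (rule emeasure_density) auto
    also have "\<dots> = (\<integral>\<^sup>+\<omega>. ennreal (?i \<omega>) * indicator A (Z \<omega>) \<partial>M)"
      by (intro nn_integral_cong) (auto split: split_indicator)
    finally show ?thesis .
  qed
  have ac: "absolutely_continuous \<mu> \<nu>"
    unfolding absolutely_continuous_def
  proof
    fix A assume "A \<in> null_sets \<mu>"
    then have A [measurable]: "A \<in> sets T" and "emeasure M (Z -` A \<inter> space M) = 0"
      by (auto simp: null_sets_def \<mu>_def emeasure_distr)
    then have "AE \<omega> in M. \<omega> \<notin> Z -` A \<inter> space M" by (intro AE_not_in) auto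
    then have "AE \<omega> in M. ennreal (?i \<omega>) * indicator A (Z \<omega>) = 0"
      using AE_space by eventually_elim (auto split: split_indicator)
    then have "emeasure \<nu> A = 0" by (subst \<nu>_eq) (auto simp: nn_integral_0_iff_AE)
    then show "A \<in> null_sets \<nu>" using A by auto
  qed
  define \<psi> where "\<psi> = RN_deriv \<mu> \<nu>"
  have \<psi>m [measurable]: "\<psi> \<in> borel_measurable T" unfolding \<psi>_def by measurable
  have dens: "density \<mu> \<psi> = \<nu>" unfolding \<psi>_def using ac by (intro \<mu>.density_RN_deriv) auto
  have \<psi>_eq: "(\<integral>\<^sup>+\<omega>. \<psi> (Z \<omega>) * indicator A (Z \<omega>) \<partial>M) = emeasure \<nu> A" if A [measurable]: "A \<in> sets T" for A
  proof -
    have "(\<integral>\<^sup>+\<omega>. \<psi> (Z \<omega>) * indicator A (Z \<omega>) \<partial>M) = (\<integral>\<^sup>+z. \<psi> z * indicator A z \<partial>\<mu>)"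
      unfolding \<mu>_def by (subst nn_integral_distr) auto
    also have "\<dots> = emeasure (density \<mu> \<psi>) A"
      by (subst emeasure_density) auto
    finally show ?thesis by (simp add: dens)
  qed
  have "Z \<in> measurable ?F T" using measurable_space[OF Z] by (intro measurable_vimage_algebra1) auto
  then have \<psi>F: "(\<lambda>\<omega>. \<psi> (Z \<omega>)) \<in> borel_measurable ?F" by measurable
  \<comment> \<open>Every event generated by \<open>Z\<close> is a preimage of some \<open>A\<close>
    in \<open>T\<close>, so the defining equation of the derivative on \<open>A\<close>, pulled back
    along \<open>Z\<close>, is the defining equation of the conditional expectation.\<close>
  have "AE \<omega> in M. \<psi> (Z \<omega>) = nn_cond_exp M ?F (\<lambda>\<omega>. ennreal (?i \<omega>)) \<omega>"
  proof (rule F.nn_cond_exp_charact[OF _ _ \<psi>F])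
    fix B assume "B \<in> sets ?F"
    then obtain A where A: "A \<in> sets T" and B: "B = Z -` A \<inter> space M"
      using measurable_space[OF Z] by (auto simp: sets_vimage_algebra2)
    have "(\<integral>\<^sup>+\<omega>\<in>B. ennreal (?i \<omega>) \<partial>M) = (\<integral>\<^sup>+\<omega>. ennreal (?i \<omega>) * indicator A (Z \<omega>) \<partial>M)"
      by (intro nn_integral_cong) (auto simp: B split: split_indicator)
    also have "\<dots> = (\<integral>\<^sup>+\<omega>. \<psi> (Z \<omega>) * indicator A (Z \<omega>) \<partial>M)"
      using A by (simp add: \<psi>_eq \<nu>_eq)
    also have "\<dots> = (\<integral>\<^sup>+\<omega>\<in>B. \<psi> (Z \<omega>) \<partial>M)"
      by (intro nn_integral_cong) (auto simp: B split: split_indicator)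
    finally show "(\<integral>\<^sup>+\<omega>\<in>B. ennreal (?i \<omega>) \<partial>M) = (\<integral>\<^sup>+\<omega>\<in>B. \<psi> (Z \<omega>) \<partial>M)" .
  qed measurable
  moreover have "AE \<omega> in M. ennreal (posterior M T Z Y y \<omega>) = nn_cond_exp M ?F (\<lambda>\<omega>. ennreal (?i \<omega>)) \<omega>"
    unfolding posterior_def by (intro F.nn_cond_exp_eq_real_cond_exp) (auto simp: less_top[symmetric])
  ultimately have \<psi>_post: "AE \<omega> in M. \<psi> (Z \<omega>) = ennreal (posterior M T Z Y y \<omega>)"
    by eventually_elim simp
  \<comment> \<open>Clipping turns the almost sure bounds into pointwise ones.\<close>
  define \<phi> where "\<phi> z = max 0 (min 1 (enn2real (\<psi> z)))" for z
  have post: "AE \<omega> in M. posterior M T Z Y y \<omega> = \<phi> (Z \<omega>)"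
    using \<psi>_post posterior_bounds[OF Z E] by eventually_elim (simp add: \<phi>_def)
  show thesis
  proof (rule that[OF _ _ _ post])
    fix A assume A [measurable]: "A \<in> sets T"
    have "emeasure M {\<omega> \<in> space M. Z \<omega> \<in> A \<and> Y \<omega> = y} = (\<integral>\<^sup>+\<omega>. indicator (Z -` A \<inter> space M \<inter> ?E) \<omega> \<partial>M)"
      by (subst nn_integral_indicator) (auto intro!: arg_cong[where f="emeasure M"])
    also have "\<dots> = (\<integral>\<^sup>+\<omega>. ennreal (?i \<omega>) * indicator A (Z \<omega>) \<partial>M)"
      by (intro nn_integral_cong) (auto split: split_indicator)
    also have "\<dots> = (\<integral>\<^sup>+\<omega>. \<psi> (Z \<omega>) * indicator A (Z \<omega>) \<partial>M)"
      using A by (simp add: \<psi>_eq \<nu>_eq)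
    also have "\<dots> = (\<integral>\<^sup>+\<omega>. ennreal (\<phi> (Z \<omega>)) * indicator A (Z \<omega>) \<partial>M)"
      by (rule nn_integral_cong_AE) (use \<psi>_post post in eventually_elim, simp)
    finally show "emeasure M {\<omega> \<in> space M. Z \<omega> \<in> A \<and> Y \<omega> = y} =
      (\<integral>\<^sup>+\<omega>. ennreal (\<phi> (Z \<omega>)) * indicator A (Z \<omega>) \<partial>M)" .
  qed (auto simp: \<phi>_def[abs_def])
qed

section \<open>Mutual information expressed through posteriors\<close>

text \<open>Turns the expectation of a function of \<open>Y\<close> into a finite sum over its
  values. The general codomain serves both \<open>ennreal\<close> and real integrals.\<close>

lemma sum_indicator_fibre:
  fixes L :: "'c \<Rightarrow> 'd::semiring_1"
  assumes "finite C" "Y \<omega> \<in> C" "\<omega> \<in> \<Omega>"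
  shows "(\<Sum>y\<in>C. L y * indicator {\<omega> \<in> \<Omega>. Y \<omega> = y} \<omega>) = L (Y \<omega>)"
proof -
  have "(\<Sum>y\<in>C. L y * indicator {\<omega> \<in> \<Omega>. Y \<omega> = y} \<omega>) = (\<Sum>y\<in>C. if y = Y \<omega> then L y else 0)"
    using assms by (intro sum.cong) (auto simp: indicator_def)
  then show ?thesis using assms by simp
qed

text \<open>With the joint density \<open>r\<close> relative to the product of the marginals, the
  divergence is the integral of \<open>r * log b r\<close> over that product. Integrating over
  \<open>z\<close> first and then averaging over \<open>Y\<close> leaves one term for each
  \<open>y\<close>, in which the weight \<open>p y\<close> cancels the denominator of
  \<open>r\<close>.\<close>

lemma (in prob_space) mutual_information_posterior:
  fixes Y :: "'a \<Rightarrow> nat"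
  assumes b: "1 < b" and C: "finite C"
    and Z [measurable]: "Z \<in> measurable M T" and Y [measurable]: "Y \<in> measurable M (count_space C)"
  shows "mutual_information b T (count_space C) Z Y =
    (\<Sum>y\<in>C. ((\<integral>\<omega>. posterior M T Z Y y \<omega> * ln (posterior M T Z Y y \<omega>) \<partial>M)
       - prob {\<omega> \<in> space M. Y \<omega> = y} * ln (prob {\<omega> \<in> space M. Y \<omega> = y})) / ln b)"
proof -
  define E where "E y = {\<omega> \<in> space M. Y \<omega> = y}" for y
  define p where "p y = prob (E y)" for y
  have YC: "Y \<omega> \<in> C" if "\<omega> \<in> space M" for \<omega>
    using measurable_space[OF Y that] by simp
  have E [measurable]: "E y \<in> sets M" for y
  proof (cases "y \<in> C")
    case True
    then have "Y -` {y} \<inter> space M \<in> sets M" by (intro measurable_sets[OF Y]) auto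
    then show ?thesis by (simp add: E_def vimage_def Int_def conj_commute)
  next
    case False
    then have "E y = {}" using YC by (auto simp: E_def)
    then show ?thesis by simp
  qed
  \<comment> \<open>Naming the conjunction lets a whole family \<open>\<phi>\<close>, one function
    for each \<open>y\<close>, be chosen at once.\<close>
  define good where "good y \<phi> \<longleftrightarrow> \<phi> \<in> borel_measurable T \<and> (\<forall>z. 0 \<le> \<phi> z) \<and> (\<forall>z. \<phi> z \<le> 1) \<and>
    (AE \<omega> in M. posterior M T Z Y y \<omega> = \<phi> (Z \<omega>)) \<and>
    (\<forall>A\<in>sets T. emeasure M {\<omega> \<in> space M. Z \<omega> \<in> A \<and> Y \<omega> = y} =
      (\<integral>\<^sup>+\<omega>. ennreal (\<phi> (Z \<omega>)) * indicator A (Z \<omega>) \<partial>M))" for y \<phi>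
  have "\<exists>\<phi>. good y \<phi>" for y
  proof -
    obtain \<phi> where "\<phi> \<in> borel_measurable T" "\<And>z. 0 \<le> \<phi> z" "\<And>z. \<phi> z \<le> 1"
      "AE \<omega> in M. posterior M T Z Y y \<omega> = \<phi> (Z \<omega>)"
      "\<And>A. A \<in> sets T \<Longrightarrow> emeasure M {\<omega> \<in> space M. Z \<omega> \<in> A \<and> Y \<omega> = y} =
        (\<integral>\<^sup>+\<omega>. ennreal (\<phi> (Z \<omega>)) * indicator A (Z \<omega>) \<partial>M)"
      by (rule posterior_factor[OF Z E[of y, unfolded E_def]]; rule that; assumption)
    then have "good y \<phi>" unfolding good_def by (intro conjI ballI allI)
    then show ?thesis by (rule exI[of "good y"])
  qed
  then obtain \<phi> where good: "good y (\<phi> y)" for y by metis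
  have \<phi>m [measurable]: "\<phi> y \<in> borel_measurable T"
    and \<phi>0: "0 \<le> \<phi> y z" and \<phi>1: "\<phi> y z \<le> 1"
    and \<phi>_post: "AE \<omega> in M. posterior M T Z Y y \<omega> = \<phi> y (Z \<omega>)"
    and \<phi>_int: "A \<in> sets T \<Longrightarrow> emeasure M {\<omega> \<in> space M. Z \<omega> \<in> A \<and> Y \<omega> = y} =
      (\<integral>\<^sup>+\<omega>. ennreal (\<phi> y (Z \<omega>)) * indicator A (Z \<omega>) \<partial>M)" for y z A
    using good[of y] unfolding good_def by (elim conjE; simp)+
  let ?S = "T \<Otimes>\<^sub>M count_space C"
  define PX where "PX = distr M T Z"
  define PY where "PY = distr M (count_space C) Y"
  define P where "P = PX \<Otimes>\<^sub>M PY"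
  define Q where "Q = distr M ?S (\<lambda>\<omega>. (Z \<omega>, Y \<omega>))"
  interpret PX: prob_space PX unfolding PX_def by (rule prob_space_distr) fact
  interpret PY: prob_space PY unfolding PY_def by (rule prob_space_distr) fact
  interpret XY: pair_prob_space PX PY ..
  interpret P: prob_space P
    unfolding P_def by (rule XY.P.prob_space_axioms)
  have sPX [simp, measurable_cong]: "sets PX = sets T" by (simp add: PX_def)
  have sPY [simp, measurable_cong]: "sets PY = sets (count_space C)" by (simp add: PY_def)
  have sP [simp, measurable_cong]: "sets P = sets ?S"
    unfolding P_def by (rule sets_pair_measure_cong) auto
  \<comment> \<open>Where \<open>p y = 0\<close>, division by zero gives the value 0. This is
    harmless: such a \<open>y\<close> carries no mass under the joint law or the product.\<close>
  define r where "r = (\<lambda>(z, y). \<phi> y z / p y)"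
  \<comment> \<open>The second coordinate ranges over a finite discrete set, so measurability only
    has to be checked for each fixed \<open>y\<close>.\<close>
  have r [measurable]: "r \<in> borel_measurable ?S"
    unfolding r_def case_prod_beta'
    by (rule measurable_compose_countable'[where f = "\<lambda>y x. \<phi> y (fst x) / p y" and g = snd and I = C])
      (use C in \<open>auto intro: countable_finite\<close>)
  have slice: "(\<lambda>z. (z, y)) \<in> measurable T ?S" "(\<lambda>\<omega>. (Z \<omega>, y)) \<in> measurable M ?S" if "y \<in> C" for y
    using that by (auto intro!: measurable_Pair)
  have r0: "0 \<le> r x" for x
    by (cases x) (simp add: r_def p_def \<phi>0)
  \<comment> \<open>Prepares the degenerate case of \<open>pK\<close>: there
    \<open>p y * K y\<close> is 0, so the integral of the posterior term has to vanish as
    well.\<close>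
  have null_p: "AE \<omega> in M. \<phi> y (Z \<omega>) = 0" if "p y = 0" for y
  proof -
    have "(\<integral>\<^sup>+\<omega>. ennreal (\<phi> y (Z \<omega>)) \<partial>M) = (\<integral>\<^sup>+\<omega>. ennreal (\<phi> y (Z \<omega>)) * indicator (space T) (Z \<omega>) \<partial>M)"
      using measurable_space[OF Z] by (intro nn_integral_cong) auto
    also have "\<dots> = emeasure M {\<omega> \<in> space M. Z \<omega> \<in> space T \<and> Y \<omega> = y}"
      by (rule \<phi>_int[symmetric]) auto
    also have "\<dots> \<le> emeasure M (E y)"
      by (rule emeasure_mono) (auto simp: E_def)
    finally have "(\<integral>\<^sup>+\<omega>. ennreal (\<phi> y (Z \<omega>)) \<partial>M) = 0"
      using that by (simp add: p_def emeasure_eq_measure)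
    then show ?thesis using \<phi>0 by (simp add: nn_integral_0_iff_AE)
  qed
  \<comment> \<open>Cut \<open>A\<close> into its slices \<open>Ay y\<close>. By Tonelli the density
    gives the slice at \<open>y\<close> the mass \<open>L y\<close>, averaged with weight
    \<open>emeasure M (E y)\<close>; this product is the joint probability of the slice, and the
    slices are disjoint.\<close>
  have Q: "Q = density P (\<lambda>x. ennreal (r x))"
  proof (rule measure_eqI)
    fix A assume "A \<in> sets Q"
    then have A [measurable]: "A \<in> sets ?S" by (simp add: Q_def)
    define Ay where "Ay y = (\<lambda>z. (z, y)) -` A \<inter> space T" for y
    have Ay [measurable]: "Ay y \<in> sets T" if "y \<in> C" for y
      unfolding Ay_def using that by (intro measurable_sets[OF slice(1) A])
    define L where "L y = (\<integral>\<^sup>+\<omega>. ennreal (r (Z \<omega>, y)) * indicator A (Z \<omega>, y) \<partial>M)" for y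
    have L: "L y * emeasure M (E y) = emeasure M {\<omega> \<in> space M. Z \<omega> \<in> Ay y \<and> Y \<omega> = y}" if y: "y \<in> C" for y
    proof (cases "p y = 0")
      case True
      then have "emeasure M (E y) = 0" by (simp add: p_def emeasure_eq_measure)
      moreover have "emeasure M {\<omega> \<in> space M. Z \<omega> \<in> Ay y \<and> Y \<omega> = y} \<le> emeasure M (E y)"
        by (rule emeasure_mono) (auto simp: E_def)
      ultimately show ?thesis by simp
    next
      case False
      then have py: "0 < p y" using measure_nonneg[of M "E y"] by (simp add: p_def less_le)
      note slice(2)[OF y, measurable]
      have "L y * emeasure M (E y) = (\<integral>\<^sup>+\<omega>. ennreal (r (Z \<omega>, y)) * indicator A (Z \<omega>, y) * ennreal (p y) \<partial>M)"
        unfolding L_def by (subst nn_integral_multc) (auto simp: p_def emeasure_eq_measure)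
      also have "\<dots> = (\<integral>\<^sup>+\<omega>. ennreal (\<phi> y (Z \<omega>)) * indicator (Ay y) (Z \<omega>) \<partial>M)"
      proof (intro nn_integral_cong)
        fix \<omega> assume "\<omega> \<in> space M"
        then have "Z \<omega> \<in> space T" by (rule measurable_space[OF Z])
        then show "ennreal (r (Z \<omega>, y)) * indicator A (Z \<omega>, y) * ennreal (p y) =
            ennreal (\<phi> y (Z \<omega>)) * indicator (Ay y) (Z \<omega>)"
          using py \<phi>0[of y "Z \<omega>"]
          by (auto simp: r_def Ay_def ennreal_mult[symmetric] split: split_indicator)
      qed
      also have "\<dots> = emeasure M {\<omega> \<in> space M. Z \<omega> \<in> Ay y \<and> Y \<omega> = y}"
        using y by (intro \<phi>_int[symmetric]) auto
      finally show ?thesis .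
    qed
    have "emeasure (density P (\<lambda>x. ennreal (r x))) A = (\<integral>\<^sup>+x. ennreal (r x) * indicator A x \<partial>P)"
      by (rule emeasure_density) auto
    also have "\<dots> = (\<integral>\<^sup>+y. \<integral>\<^sup>+z. ennreal (r (z, y)) * indicator A (z, y) \<partial>PX \<partial>PY)"
      unfolding P_def by (rule XY.nn_integral_snd[symmetric]) (simp flip: P_def)
    also have "\<dots> = (\<integral>\<^sup>+y. L y \<partial>PY)"
    proof (rule nn_integral_cong)
      fix y assume "y \<in> space PY"
      then have y: "y \<in> C" by (simp add: PY_def)
      note slice(1)[OF y, measurable]
      show "(\<integral>\<^sup>+z. ennreal (r (z, y)) * indicator A (z, y) \<partial>PX) = L y"
        unfolding PX_def L_def by (subst nn_integral_distr) auto
    qed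
    also have "\<dots> = (\<integral>\<^sup>+\<omega>. L (Y \<omega>) \<partial>M)"
      unfolding PY_def by (subst nn_integral_distr) auto
    also have "\<dots> = (\<integral>\<^sup>+\<omega>. (\<Sum>y\<in>C. L y * indicator (E y) \<omega>) \<partial>M)"
      unfolding E_def by (intro nn_integral_cong sum_indicator_fibre[symmetric] C YC)
    also have "\<dots> = (\<Sum>y\<in>C. L y * emeasure M (E y))"
      by (subst nn_integral_sum) (auto simp: nn_integral_cmult)
    also have "\<dots> = (\<Sum>y\<in>C. emeasure M {\<omega> \<in> space M. Z \<omega> \<in> Ay y \<and> Y \<omega> = y})"
      using L by (intro sum.cong) auto
    also have "\<dots> = emeasure M (\<Union>y\<in>C. {\<omega> \<in> space M. Z \<omega> \<in> Ay y \<and> Y \<omega> = y})"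
    proof (rule sum_emeasure)
      show "(\<lambda>y. {\<omega> \<in> space M. Z \<omega> \<in> Ay y \<and> Y \<omega> = y}) ` C \<subseteq> sets M"
      proof safe
        fix y assume y: "y \<in> C"
        have "Z -` Ay y \<inter> space M \<inter> E y \<in> sets M"
          using measurable_sets[OF Z Ay[OF y]] by auto
        then show "{\<omega> \<in> space M. Z \<omega> \<in> Ay y \<and> Y \<omega> = y} \<in> sets M"
          by (rule back_subst[of "\<lambda>B. B \<in> sets M"]) (auto simp: E_def)
      qed
    qed (auto simp: disjoint_family_on_def C)
    also have "(\<Union>y\<in>C. {\<omega> \<in> space M. Z \<omega> \<in> Ay y \<and> Y \<omega> = y}) = (\<lambda>\<omega>. (Z \<omega>, Y \<omega>)) -` A \<inter> space M"
      using measurable_space[OF Z] YC by (auto simp: Ay_def)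
    also have "emeasure M \<dots> = emeasure Q A"
      unfolding Q_def by (rule emeasure_distr[symmetric]) auto
    finally show "emeasure Q A = emeasure (density P (\<lambda>x. ennreal (r x))) A" ..
  qed (simp add: Q_def)
  define K where "K y = (\<integral>\<omega>. r (Z \<omega>, y) * log b (r (Z \<omega>, y)) \<partial>M)" for y
  \<comment> \<open>The bound does not depend on \<open>z\<close>: the numerator of
    \<open>r * log b r\<close> over \<open>p y * ln b\<close> is at most 1 from
    \<open>\<phi> * ln \<phi>\<close> plus \<open>\<bar>ln (p y)\<bar>\<close> from the
    prior.\<close>
  have Kb: "\<bar>r (z, y) * log b (r (z, y))\<bar> \<le> (if p y = 0 then 0 else (1 + \<bar>ln (p y)\<bar>) / (p y * ln b))" for z y
  proof (cases "p y = 0 \<or> \<phi> y z = 0")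
    case True
    then show ?thesis using b measure_nonneg[of M "E y"] by (auto simp: r_def p_def)
  next
    case False
    then have pos: "0 < p y" "0 < \<phi> y z" using measure_nonneg[of M "E y"] \<phi>0[of y z] by (auto simp: less_le p_def)
    have "r (z, y) * log b (r (z, y)) = (\<phi> y z * ln (\<phi> y z) - \<phi> y z * ln (p y)) / (p y * ln b)"
      using pos by (simp add: r_def log_def ln_div diff_divide_distrib right_diff_distrib mult.commute)
    moreover have "\<bar>\<phi> y z * ln (\<phi> y z) - \<phi> y z * ln (p y)\<bar> \<le> 1 + \<bar>ln (p y)\<bar>"
    proof -
      have "\<bar>\<phi> y z * ln (p y)\<bar> \<le> \<bar>ln (p y)\<bar>"
        using \<phi>0[of y z] \<phi>1[of y z] by (simp add: abs_mult mult_left_le_one_le)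
      then show ?thesis using abs_mult_ln_le_1[OF \<phi>0 \<phi>1, of y z] by linarith
    qed
    ultimately show ?thesis using pos b by (auto simp: abs_divide abs_mult intro!: divide_right_mono)
  qed
  \<comment> \<open>Expanding the logarithm of the quotient \<open>r\<close> separates posterior and
    prior. The mean of \<open>\<phi> y\<close> along \<open>Z\<close> is \<open>p y\<close>, which
    turns the prior part into \<open>p y * ln (p y)\<close>.\<close>
  have pK: "p y * K y = ((\<integral>\<omega>. posterior M T Z Y y \<omega> * ln (posterior M T Z Y y \<omega>) \<partial>M) - p y * ln (p y)) / ln b"
    if y: "y \<in> C" for y
  proof -
    have H: "(\<integral>\<omega>. posterior M T Z Y y \<omega> * ln (posterior M T Z Y y \<omega>) \<partial>M) = (\<integral>\<omega>. \<phi> y (Z \<omega>) * ln (\<phi> y (Z \<omega>)) \<partial>M)"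
    proof (rule integral_cong_AE)
      show "(\<lambda>\<omega>. posterior M T Z Y y \<omega> * ln (posterior M T Z Y y \<omega>)) \<in> borel_measurable M"
        unfolding posterior_def by measurable
    qed (use \<phi>_post[of y] in \<open>auto elim: eventually_mono\<close>)
    show ?thesis
    proof (cases "p y = 0")
      case True
      have "(\<integral>\<omega>. \<phi> y (Z \<omega>) * ln (\<phi> y (Z \<omega>)) \<partial>M) = (\<integral>\<omega>. 0 \<partial>M)"
        using null_p[OF True] by (intro integral_cong_AE) (auto elim: eventually_mono)
      then show ?thesis using True by (simp add: H)
    next
      case False
      then have py: "0 < p y" using measure_nonneg[of M "E y"] by (simp add: p_def less_le)
      have "emeasure M (E y) = (\<integral>\<^sup>+\<omega>. ennreal (\<phi> y (Z \<omega>)) \<partial>M)"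
      proof -
        have "E y = {\<omega> \<in> space M. Z \<omega> \<in> space T \<and> Y \<omega> = y}"
          using measurable_space[OF Z] by (auto simp: E_def)
        then have "emeasure M (E y) = (\<integral>\<^sup>+\<omega>. ennreal (\<phi> y (Z \<omega>)) * indicator (space T) (Z \<omega>) \<partial>M)"
          using \<phi>_int[of "space T" y] by simp
        also have "\<dots> = (\<integral>\<^sup>+\<omega>. ennreal (\<phi> y (Z \<omega>)) \<partial>M)"
          using measurable_space[OF Z] by (intro nn_integral_cong) auto
        finally show ?thesis .
      qed
      then have E\<phi>: "(\<integral>\<omega>. \<phi> y (Z \<omega>) \<partial>M) = p y"
        by (subst integral_eq_nn_integral) (auto simp: \<phi>0 p_def measure_def)
      have i1: "integrable M (\<lambda>\<omega>. \<phi> y (Z \<omega>) * ln (\<phi> y (Z \<omega>)))"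
        using abs_mult_ln_le_1[OF \<phi>0 \<phi>1] by (intro integrable_const_bound[where B=1]) (auto simp del: abs_mult)
      have i2: "integrable M (\<lambda>\<omega>. \<phi> y (Z \<omega>))"
        using \<phi>0 \<phi>1 by (intro integrable_const_bound[where B=1]) auto
      have "p y * K y = (\<integral>\<omega>. p y * (r (Z \<omega>, y) * log b (r (Z \<omega>, y))) \<partial>M)"
        unfolding K_def by simp
      also have "\<dots> = (\<integral>\<omega>. (\<phi> y (Z \<omega>) * ln (\<phi> y (Z \<omega>)) - \<phi> y (Z \<omega>) * ln (p y)) / ln b \<partial>M)"
      proof (rule Bochner_Integration.integral_cong[OF refl])
        fix \<omega>
        show "p y * (r (Z \<omega>, y) * log b (r (Z \<omega>, y))) =
            (\<phi> y (Z \<omega>) * ln (\<phi> y (Z \<omega>)) - \<phi> y (Z \<omega>) * ln (p y)) / ln b"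
        proof (cases "\<phi> y (Z \<omega>) = 0")
          case False
          then have "0 < \<phi> y (Z \<omega>)" using \<phi>0[of y "Z \<omega>"] by simp
          then show ?thesis using py by (simp add: r_def log_def ln_div algebra_simps)
        qed (simp add: r_def)
      qed
      also have "\<dots> = ((\<integral>\<omega>. \<phi> y (Z \<omega>) * ln (\<phi> y (Z \<omega>)) \<partial>M) - p y * ln (p y)) / ln b"
        using i1 i2 by (simp add: E\<phi>)
      finally show ?thesis by (simp add: H)
    qed
  qed
  have "mutual_information b T (count_space C) Z Y = KL_divergence b P Q"
    by (simp add: mutual_information_def P_def Q_def PX_def PY_def)
  also have "\<dots> = (\<integral>x. r x * log b (r x) \<partial>P)"
    unfolding Q using b r0 by (intro P.KL_density) auto
  also have "\<dots> = (\<integral>y. \<integral>z. r (z, y) * log b (r (z, y)) \<partial>PX \<partial>PY)"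
  proof -
    have "integrable P (\<lambda>x. r x * log b (r x))"
    proof (rule P.integrable_const_bound)
      \<comment> \<open>Summing the nonnegative bounds of \<open>Kb\<close> over the finite set
        \<open>C\<close> gives one constant for all \<open>y\<close>, hence the integrability that
        Fubini requires.\<close>
      define B where "B = (\<Sum>y\<in>C. if p y = 0 then 0 else (1 + \<bar>ln (p y)\<bar>) / (p y * ln b))"
      show "AE x in P. norm (r x * log b (r x)) \<le> B"
      proof (rule AE_I2)
        fix x assume "x \<in> space P"
        then have "x \<in> space ?S" using sets_eq_imp_space_eq[OF sP] by simp
        then obtain z y where x: "x = (z, y)" and y: "y \<in> C"
          by (cases x) (auto simp: space_pair_measure)
        have "(if p y = 0 then 0 else (1 + \<bar>ln (p y)\<bar>) / (p y * ln b)) \<le> B"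
          unfolding B_def using y C b by (intro member_le_sum) (auto simp: p_def)
        then show "norm (r x * log b (r x)) \<le> B"
          using Kb[of z y] by (simp add: x del: abs_mult)
      qed
    qed measurable
    then show ?thesis
      unfolding P_def using XY.integral_snd[of "\<lambda>z y. r (z, y) * log b (r (z, y))"] by (simp add: case_prod_beta')
  qed
  also have "\<dots> = (\<integral>y. K y \<partial>PY)"
  proof (rule Bochner_Integration.integral_cong[OF refl])
    fix y assume "y \<in> space PY"
    then have y: "y \<in> C" by (simp add: PY_def)
    note slice(1)[OF y, measurable]
    show "(\<integral>z. r (z, y) * log b (r (z, y)) \<partial>PX) = K y"
      unfolding PX_def K_def by (subst integral_distr) auto
  qed
  also have "\<dots> = (\<integral>\<omega>. K (Y \<omega>) \<partial>M)"
    unfolding PY_def by (subst integral_distr) auto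
  also have "\<dots> = (\<integral>\<omega>. (\<Sum>y\<in>C. K y * indicator (E y) \<omega>) \<partial>M)"
    unfolding E_def by (intro Bochner_Integration.integral_cong refl sum_indicator_fibre[symmetric] C YC)
  also have "\<dots> = (\<Sum>y\<in>C. p y * K y)"
    by (subst Bochner_Integration.integral_sum) (auto simp: p_def mult.commute less_top[symmetric])
  also have "\<dots> = (\<Sum>y\<in>C. ((\<integral>\<omega>. posterior M T Z Y y \<omega> * ln (posterior M T Z Y y \<omega>) \<partial>M) - p y * ln (p y)) / ln b)"
    using pK by (intro sum.cong) auto
  finally show ?thesis unfolding p_def E_def .
qed

section \<open>Comparing an observation with a function of it\<close>

text \<open>As \<open>W\<close> is a function of \<open>Z\<close>, it generates a smaller
  sigma-algebra. By the tower property the posterior given \<open>W\<close> is the conditional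
  expectation of the posterior given \<open>Z\<close>, so \<open>cond_exp_mult_ln\<close> applies
  for each \<open>y\<close>.\<close>

lemma (in prob_space) posterior_eq_iff_mutual_information_eq:
  fixes Y :: "'a \<Rightarrow> nat"
  assumes b: "1 < b" and C: "finite C"
    and Z [measurable]: "Z \<in> measurable M T" and h [measurable]: "h \<in> measurable T U"
    and W: "\<And>\<omega>. \<omega> \<in> space M \<Longrightarrow> W \<omega> = h (Z \<omega>)"
    and Y [measurable]: "Y \<in> measurable M (count_space C)"
  shows "(\<forall>y\<in>C. AE \<omega> in M. posterior M T Z Y y \<omega> = posterior M U W Y y \<omega>) \<longleftrightarrow>
    mutual_information b T (count_space C) Z Y = mutual_information b U (count_space C) W Y"
proof -
  let ?F = "vimage_algebra (space M) Z T" and ?G = "vimage_algebra (space M) W U"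
  let ?H = "\<lambda>f. \<integral>\<omega>. f \<omega> * ln (f \<omega>) \<partial>M"
  let ?f = "\<lambda>y. posterior M T Z Y y" and ?g = "\<lambda>y. posterior M U W Y y"
  have Wm [measurable]: "W \<in> measurable M U"
    using measurable_compose[OF Z h] by (subst measurable_cong[OF W])
  have F: "subalgebra M ?F" and G: "subalgebra M ?G"
    by (auto intro: subalgebra_vimage_algebra)
  have "Z \<in> measurable ?F T" using measurable_space[OF Z] by (intro measurable_vimage_algebra1) auto
  then have "(\<lambda>\<omega>. h (Z \<omega>)) \<in> measurable ?F U" by (rule measurable_compose) fact
  then have "W \<in> measurable ?F U" by (subst measurable_cong[where g = "\<lambda>\<omega>. h (Z \<omega>)"]) (auto simp: W)
  from subalgebra_vimage_algebra[OF this] have GF: "subalgebra ?F ?G" by simp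
  interpret G: finite_measure_subalgebra M ?G by standard (rule G)
  have E: "{\<omega> \<in> space M. Y \<omega> = y} \<in> sets M" if "y \<in> C" for y
  proof -
    have "Y -` {y} \<inter> space M \<in> sets M" using that by (intro measurable_sets[OF Y]) auto
    then show ?thesis by (simp add: vimage_def Int_def conj_commute)
  qed
  have *: "?H (?g y) \<le> ?H (?f y) \<and> (?H (?g y) = ?H (?f y) \<longleftrightarrow> (AE \<omega> in M. ?f y \<omega> = ?g y \<omega>))"
    if y: "y \<in> C" for y
  proof -
    let ?g' = "real_cond_exp M ?G (?f y)"
    have fm: "?f y \<in> borel_measurable M" unfolding posterior_def by measurable
    have gm [measurable]: "?g y \<in> borel_measurable M" unfolding posterior_def by measurable
    have g': "AE \<omega> in M. ?g' \<omega> = ?g y \<omega>"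
      unfolding posterior_def using E[OF y]
      by (intro G.real_cond_exp_nested_subalg[OF F GF]) (simp add: less_top[symmetric])
    have "?H ?g' = ?H (?g y)"
      by (rule integral_cong_AE) (use g' in \<open>auto elim: eventually_mono\<close>)
    moreover have "(AE \<omega> in M. ?f y \<omega> = ?g' \<omega>) \<longleftrightarrow> (AE \<omega> in M. ?f y \<omega> = ?g y \<omega>)"
      using g' by (intro eventually_cong) auto
    ultimately show ?thesis
      using cond_exp_mult_ln[OF G fm posterior_bounds[OF Z E[OF y]]] by simp
  qed
  \<comment> \<open>The prior terms depend only on \<open>Y\<close> and cancel, leaving the Jensen
    differences.\<close>
  have diff: "mutual_information b T (count_space C) Z Y - mutual_information b U (count_space C) W Y =
    (\<Sum>y\<in>C. ?H (?f y) - ?H (?g y)) / ln b"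
    unfolding mutual_information_posterior[OF b C Z Y] mutual_information_posterior[OF b C Wm Y]
      sum_subtractf[symmetric] sum_divide_distrib diff_divide_distrib[symmetric]
    by (intro sum.cong refl arg_cong[where f = "\<lambda>t. t / ln b"]) linarith
  have "ln b \<noteq> 0" using b by simp
  then have "mutual_information b T (count_space C) Z Y = mutual_information b U (count_space C) W Y \<longleftrightarrow>
    (\<Sum>y\<in>C. ?H (?f y) - ?H (?g y)) = 0"
    unfolding eq_iff_diff_eq_0[of "mutual_information b T (count_space C) Z Y"] diff
    by (simp only: divide_eq_0_iff simp_thms)
  \<comment> \<open>Each Jensen difference is nonnegative, so none can compensate for
    another.\<close>
  also have "\<dots> \<longleftrightarrow> (\<forall>y\<in>C. ?H (?f y) - ?H (?g y) = 0)"
    by (rule sum_nonneg_eq_0_iff[OF C]) (simp add: *)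
  also have "\<dots> \<longleftrightarrow> (\<forall>y\<in>C. AE \<omega> in M. ?f y \<omega> = ?g y \<omega>)"
  proof (rule ball_cong[OF refl])
    fix y assume "y \<in> C"
    from *[OF this] show "?H (?f y) - ?H (?g y) = 0 \<longleftrightarrow> (AE \<omega> in M. ?f y \<omega> = ?g y \<omega>)"
      by (simp only: right_minus_eq eq_commute[of "?H (?f y)"])
  qed
  finally show ?thesis ..
qed

theorem mainTheorem1:
  fixes M :: "'a measure"
    and b :: real
    and X :: "nat \<Rightarrow> 'a \<Rightarrow> real"
    and Y :: "'a \<Rightarrow> nat"
    and n c k :: nat
    and S :: "nat set"
  assumes "information_space M b"
    and "\<And>i. i \<in> {1..n} \<Longrightarrow> continuous_rv M (X i)"
    and "Y \<in> measurable M (count_space {1..c})"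
    and "S \<subseteq> {1..n}" and "card S = k" and "1 \<le> k" and "k \<le> n"
  shows "(\<forall>y\<in>{1..c}. AE \<omega> in M.
            posterior M (rvec_space {1..n}) (rvec {1..n} X) Y y \<omega> =
            posterior M (rvec_space S) (rvec S X) Y y \<omega>)
      \<longleftrightarrow>
         prob_space.mutual_information M b (rvec_space {1..n}) (count_space {1..c})
           (rvec {1..n} X) Y =
         prob_space.mutual_information M b (rvec_space S) (count_space {1..c})
           (rvec S X) Y"
proof -
  interpret information_space M b by fact
  show ?thesis
  \<comment> \<open>Here \<open>h\<close> restricts a tuple to the coordinates in \<open>S\<close>.
    Both sides of the last goal are \<open>undefined\<close> outside \<open>S\<close>, so they agree
    as total functions.\<close>
  proof (rule posterior_eq_iff_mutual_information_eq[OF b_gt_1 _ _ _ _ assms(3)])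
    show "rvec {1..n} X \<in> measurable M (rvec_space {1..n})"
      unfolding rvec_def[abs_def] rvec_space_def
      using assms(2) by (intro measurable_restrict) (auto simp: continuous_rv_def)
    show "(\<lambda>x. restrict x S) \<in> measurable (rvec_space {1..n}) (rvec_space S)"
      unfolding rvec_space_def using assms(4) by (rule measurable_restrict_subset)
    show "rvec S X \<omega> = restrict (rvec {1..n} X \<omega>) S" for \<omega>
      using assms(4) by (auto simp: rvec_def restrict_def fun_eq_iff)
  qed simp
qed

end
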